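(* Let $R$ be a dedekind type domain, let $\mathit{M}(R)$ be the monoid generated by the maximal ideals of $R$, let $r\ge2$, $k\ge2$, and let $\mathcal{I}_1,\dots,\mathcal{I}_r\in\mathit{M}(R)$ be pairwise comaximal. Let $M(r,k)(R)=\{A=[a_{ij}]_{r\times k}\mid \sum_{j=1}^k\prod_{i=1}^r a_{ij}=1\}$. Then the map $\lambda:M(r,k)(R)\to\mathbb{PF}^{k-1}_{\mathcal{I}_1}\times\cdots\times\mathbb{PF}^{k-1}_{\mathcal{I}_r}$, $\lambda(A)=([a_{11}:\dots:a_{1k}],\dots,[a_{r1}:\dots:a_{rk}])$, is surjective.
   Context: Dedekind type domain: a commutative ring $R$ with unity which is a field, or in which every maximal ideal $\mathcal{M}$ satisfies $\mathcal{M}^i\neq\mathcal{M}^{i+1}$ ($i\ge0$), $\bigcap_{i\ge0}\mathcal{M}^i=(0)$, $\dim_{R/\mathcal{M}}\mathcal{M}^i/\mathcal{M}^{i+1}=1$ ($i\ge0$), and every nonzero element lies in only finitely many maximal ideals. $\mathit{M}(R)$ is the set of finite products of maximal ideals ($R$ the empty product). For an ideal $\mathcal{I}$, $\mathbb{PF}^{n}_{\mathcal{I}}$ is the set of unital tuples $(a_0,\dots,a_n)$ (generating $R$) modulo $(a_i)\sim(b_i)\iff a_ib_j-a_jb_i\in\mathcal{I}$ for all $i<j$; $[a_0:\dots:a_n]$ denotes the class. *)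

theory Defs
  imports
    "HOL-Algebra.Ideal_Product"
    "HOL-Algebra.QuotRing"
    "Jordan_Normal_Form.Missing_VectorSpace"
begin

text \<open>The quotient \<open>M\<^sup>i / M\<^sup>i\<^sup>+\<^sup>1\<close> as a module over \<open>R Quot M\<close>, powers being taken in the monoid of ideals.
  A coset \<open>M + a\<close> acts on \<open>M\<^sup>i\<^sup>+\<^sup>1 + x\<close> by \<open>M\<^sup>i\<^sup>+\<^sup>1 + a x\<close>; the fields \<open>mult\<close> and \<open>one\<close> exist only
  because modules extend the ring record.\<close>

definition ideal_layer :: "('a, 'b) ring_scheme \<Rightarrow> 'a set \<Rightarrow> nat \<Rightarrow> ('a set, 'a set) module" where
  "ideal_layer R M i =
    (let J = M [^]\<^bsub>ideals_set R\<^esub> i; K = M [^]\<^bsub>ideals_set R\<^esub> Suc i in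
     \<lparr>carrier = (\<lambda>x. K +>\<^bsub>R\<^esub> x) ` J,
      mult = rcoset_mult R K,
      one = K,
      zero = K,
      add = set_add R,
      smult = rcoset_mult R K\<rparr>)"

lemma (in cring) rcoset_smult:
  assumes M: "ideal M R" and J: "ideal J R" and a: "a \<in> carrier R" and x: "x \<in> J"
  shows "rcoset_mult R (J \<cdot> M) (M +> a) ((J \<cdot> M) +> x) = (J \<cdot> M) +> (a \<otimes> x)"
proof -
  interpret M: ideal M R by fact
  interpret J: ideal J R by fact
  interpret K: ideal "J \<cdot> M" R by (rule ideal_prod_is_ideal[OF J M])
  have K_J: "k \<in> J" if "k \<in> J \<cdot> M" for k
    using ideal_prod_inter[OF J M] that by blast
  have eq: "(J \<cdot> M) +> (a' \<otimes> y) = (J \<cdot> M) +> (a \<otimes> x)"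
    if a': "a' \<in> M +> a" and y: "y \<in> (J \<cdot> M) +> x" for a' y
  proof -
    from a' obtain m where m: "m \<in> M" "a' = m \<oplus> a" by (auto simp: a_r_coset_def')
    from y obtain k where k: "k \<in> J \<cdot> M" "y = k \<oplus> x" by (auto simp: a_r_coset_def')
    have c: "m \<in> carrier R" "k \<in> carrier R" "x \<in> carrier R" "k \<in> J"
      using m k x K_J M.Icarr K.Icarr J.Icarr by auto
    have "x \<otimes> m \<in> J \<cdot> M" by (rule ideal_prod.prod[OF x m(1)])
    hence mx: "m \<otimes> x \<in> J \<cdot> M" using c m_comm by simp
    have z: "a' \<otimes> k \<oplus> m \<otimes> x \<in> J \<cdot> M"
      using K.I_l_closed[OF k(1), of a'] mx m(2) c a by (auto intro: K.a_closed)
    have "a' \<otimes> y = (a' \<otimes> k \<oplus> m \<otimes> x) \<oplus> a \<otimes> x"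
      using m k c a by (simp add: r_distr l_distr a_assoc)
    hence "a' \<otimes> y \<in> (J \<cdot> M) +> (a \<otimes> x)"
      using z by (auto simp: a_r_coset_def')
    thus ?thesis
      using K.a_repr_independence'[of "a' \<otimes> y" "a \<otimes> x"] a c by simp
  qed
  have "a \<in> M +> a" "x \<in> (J \<cdot> M) +> x"
    using M.a_rcos_self[OF a] K.a_rcos_self x J.Icarr by auto
  with eq show ?thesis unfolding rcoset_mult_def by blast
qed

lemma (in cring) ideal_power_is_ideal:
  assumes "ideal M R"
  shows "ideal (M [^]\<^bsub>ideals_set R\<^esub> (i::nat)) R"
proof -
  interpret I: comm_monoid "ideals_set R" by (rule ideals_set_is_comm_monoid)
  show ?thesis using I.nat_pow_closed[of M i] assms by (simp add: ideals_set_def)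
qed

lemma (in cring) vectorspace_ideal_layer:
  assumes "maximalideal M R"
  shows "vectorspace (R Quot M) (ideal_layer R M i)"
proof -
  define J where "J = M [^]\<^bsub>ideals_set R\<^esub> i"
  define K where "K = J \<cdot> M"
  interpret M: maximalideal M R by fact
  have idM: "ideal M R" by (rule M.ideal_axioms)
  interpret J: ideal J R unfolding J_def by (rule ideal_power_is_ideal[OF idM])
  interpret K: ideal K R unfolding K_def by (rule ideal_prod_is_ideal[OF J.ideal_axioms idM])
  have V: "ideal_layer R M i = \<lparr>carrier = (\<lambda>x. K +> x) ` J, mult = rcoset_mult R K, one = K,
      zero = K, add = set_add R, smult = rcoset_mult R K\<rparr>"
    by (simp add: ideal_layer_def J_def K_def ideals_set_def Let_def)
  interpret F: field "R Quot M" by (rule M.quotient_is_field[OF is_cring])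
  have add: "(K +> x) <+> (K +> y) = K +> (x \<oplus> y)" if "x \<in> J" "y \<in> J" for x y
    using K.a_rcos_sum that J.Icarr by simp
  have sm: "rcoset_mult R K (M +> a) (K +> x) = K +> (a \<otimes> x)" if "a \<in> carrier R" "x \<in> J" for a x
    unfolding K_def by (rule rcoset_smult[OF idM J.ideal_axioms that])
  have zero: "K = K +> \<zero>" using K.a_rcos_const[OF K.zero_closed] by simp
  have grp: "abelian_group (ideal_layer R M i)"
  proof (rule abelian_groupI, goal_cases)
    case (6 X)
    then obtain x where x: "x \<in> J" "X = K +> x" by (auto simp: V)
    have n: "\<ominus> x \<in> J" using x J.a_inv_closed by simp
    show ?case
      using x n add[OF n x(1)] zero J.Icarr by (auto simp: V l_neg intro!: bexI[of _ "K +> (\<ominus> x)"])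
  next
    case (5 X)
    then show ?case using add[of \<zero>] zero J.Icarr J.zero_closed by (auto simp: V)
  next
    case 2 then show ?case using zero J.zero_closed by (auto simp: V)
  next
    case (3 X Y Z) then show ?case by (auto simp: V add J.a_closed J.Icarr a_assoc)
  next
    case (4 X Y) then show ?case by (auto simp: V add J.Icarr a_comm)
  qed (auto simp: V add J.a_closed)
  have "module (R Quot M) (ideal_layer R M i)"
  proof (rule moduleI[OF F.is_cring grp], goal_cases)
    case 5
    then show ?case
      by (auto simp: V FactRing_def A_RCOSETS_def' sm J.I_l_closed J.Icarr)
  qed (auto simp: V FactRing_def A_RCOSETS_def' sm add J.I_l_closed J.Icarr J.a_closed
        M.a_rcos_sum M.rcoset_mult_add l_distr r_distr m_assoc)
  thus ?thesis by (intro vectorspace.intro F.field_axioms)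
qed

text \<open>The library's \<open>dim\<close> is the least cardinality of a finite generating set, hence meaningful only
  together with \<open>fin_dim\<close>.\<close>

locale dedekind_type_domain = cring R for R (structure) +
  assumes field_or_dedekind_type:
    "field R \<or>
     ((\<forall>M. maximalideal M R \<longrightarrow>
         (\<forall>i::nat. M [^]\<^bsub>ideals_set R\<^esub> i \<noteq> M [^]\<^bsub>ideals_set R\<^esub> Suc i) \<and>
         (\<Inter>i::nat. M [^]\<^bsub>ideals_set R\<^esub> i) = {\<zero>} \<and>
         (\<forall>i. vectorspace.fin_dim (R Quot M) (ideal_layer R M i) \<and>
              vectorspace.dim (R Quot M) (ideal_layer R M i) = 1)) \<and>
      (\<forall>x \<in> carrier R - {\<zero>}. finite {M. maximalideal M R \<and> x \<in> M}))"

inductive_set maximal_ideal_monoid :: "('a, 'b) ring_scheme \<Rightarrow> 'a set set"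
  for R (structure) where
    unit: "carrier R \<in> maximal_ideal_monoid R"
  | mult: "\<lbrakk>maximalideal M R; I \<in> maximal_ideal_monoid R\<rbrakk> \<Longrightarrow> M \<cdot> I \<in> maximal_ideal_monoid R"

definition unital_tuples :: "('a, 'b) ring_scheme \<Rightarrow> nat \<Rightarrow> (nat \<Rightarrow> 'a) set" where
  "unital_tuples R n = {a \<in> {..n} \<rightarrow>\<^sub>E carrier R. Idl\<^bsub>R\<^esub> (a ` {..n}) = carrier R}"

definition proj_rel ::
    "('a, 'b) ring_scheme \<Rightarrow> 'a set \<Rightarrow> nat \<Rightarrow> ((nat \<Rightarrow> 'a) \<times> (nat \<Rightarrow> 'a)) set" where
  "proj_rel R I n = {(a, b). a \<in> unital_tuples R n \<and> b \<in> unital_tuples R n \<and>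
     (\<forall>i j. i < j \<and> j \<le> n \<longrightarrow> (a i \<otimes>\<^bsub>R\<^esub> b j) \<ominus>\<^bsub>R\<^esub> (a j \<otimes>\<^bsub>R\<^esub> b i) \<in> I)}"

definition PF :: "('a, 'b) ring_scheme \<Rightarrow> 'a set \<Rightarrow> nat \<Rightarrow> (nat \<Rightarrow> 'a) set set" where
  "PF R I n = unital_tuples R n // proj_rel R I n"

definition proj_class ::
    "('a, 'b) ring_scheme \<Rightarrow> 'a set \<Rightarrow> nat \<Rightarrow> (nat \<Rightarrow> 'a) \<Rightarrow> (nat \<Rightarrow> 'a) set" where
  "proj_class R I n a = proj_rel R I n `` {a}"

text \<open>Rows, columns and the ideals are indexed from \<open>0\<close>; a matrix is its function of rows.\<close>

definition mat_variety :: "('a, 'b) ring_scheme \<Rightarrow> nat \<Rightarrow> nat \<Rightarrow> (nat \<Rightarrow> nat \<Rightarrow> 'a) set" where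
  "mat_variety R r k = {A \<in> {..<r} \<rightarrow>\<^sub>E ({..<k} \<rightarrow>\<^sub>E carrier R).
     (\<Oplus>\<^bsub>R\<^esub>j\<in>{..<k}. \<Otimes>\<^bsub>R\<^esub>i\<in>{..<r}. A i j) = \<one>\<^bsub>R\<^esub>}"

definition row_class_map ::
    "('a, 'b) ring_scheme \<Rightarrow> (nat \<Rightarrow> 'a set) \<Rightarrow> nat \<Rightarrow> nat \<Rightarrow> (nat \<Rightarrow> nat \<Rightarrow> 'a) \<Rightarrow>
      (nat \<Rightarrow> (nat \<Rightarrow> 'a) set)" where
  "row_class_map R I r k A = (\<lambda>i\<in>{..<r}. proj_class R (I i) (k - 1) (A i))"

end

theory Submission
  imports Defs "HOL-Algebra.Ring_Divisibility"
begin

text \<open>Only two facts about \<open>R\<close> matter: a nonzero element lies in finitely many maximal ideals, and the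
  ideals are pairwise comaximal. Let \<open>b\<^sub>i\<close> be the prescribed rows, \<open>m\<close> the last index and \<open>d\<close> such that
  \<open>\<Sum>\<^sub>j b\<^sub>m\<^sub>j d\<^sub>j = 1\<close>. By the Chinese remainder theorem choose the rows \<open>i < m\<close> congruent to \<open>b\<^sub>i\<close> modulo
  \<open>I\<^sub>i\<close>, to \<open>1\<close> modulo the other \<open>I\<^sub>l\<close> with \<open>l < m\<close>, and with product \<open>d\<close> modulo \<open>I\<^sub>m\<close>. Their product \<open>p\<close>
  is then unital modulo every \<open>I\<^sub>l\<close>. A maximal ideal that contains no \<open>I\<^sub>l\<close> is comaximal to all of them,
  so a change of column \<open>0\<close> within the congruences makes \<open>p\<^sub>0\<close> nonzero, and a change of column \<open>1\<close> makes
  \<open>p\<^sub>1 \<equiv> 1\<close> modulo the finitely many such maximal ideals that contain \<open>p\<^sub>0\<close>. Now \<open>p\<close> is unital, say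
  \<open>\<Sum>\<^sub>j p\<^sub>j c\<^sub>j = 1\<close>, and \<open>t = \<Sum>\<^sub>j p\<^sub>j b\<^sub>m\<^sub>j - 1\<close> lies in \<open>I\<^sub>m\<close>, so \<open>b\<^sub>m - t c\<close> is a suitable last row.\<close>

context cring
begin

section \<open>Existence of maximal ideals\<close>

lemma obtain_maximalideal:
  assumes I: "ideal I R" and proper: "I \<noteq> carrier R"
  obtains M where "maximalideal M R" "I \<subseteq> M"
proof -
  let ?A = "{J. ideal J R \<and> I \<subseteq> J \<and> \<one> \<notin> J}"
  have IA: "I \<in> ?A"
    using I proper ideal.one_imp_carrier by auto
  have "\<exists>M\<in>?A. \<forall>X\<in>?A. M \<subseteq> X \<longrightarrow> X = M"
  proof (rule subset_Zorn)
    fix C assume C: "subset.chain ?A C"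
    show "\<exists>U\<in>?A. \<forall>X\<in>C. X \<subseteq> U"
    \<comment> \<open>The union of the empty chain is empty and hence no ideal; there
      \<open>I\<close> itself is the upper bound.\<close>
    proof (cases "C = {}")
      case True
      then show ?thesis using IA by blast
    next
      case False
      have "subset.chain {J. ideal J R} C"
        using C by (auto simp: subset_chain_def)
      then have "ideal (\<Union>C) R"
        using chain_Union_is_ideal[of C] False by simp
      with C False have "\<Union>C \<in> ?A"
        by (auto simp: subset_chain_def)
      then show ?thesis by blast
    qed
  qed
  then obtain M where "M \<in> ?A" and max: "\<forall>X\<in>?A. M \<subseteq> X \<longrightarrow> X = M"
    by (rule bexE)
  then have M: "ideal M R" "I \<subseteq> M" "\<one> \<notin> M"
    by simp_all
  have "maximalideal M R"
  proof (rule maximalidealI[OF M(1)])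
    show "carrier R \<noteq> M" using M(3) by auto
    show "J = M \<or> J = carrier R" if "ideal J R" "M \<subseteq> J" "J \<subseteq> carrier R" for J
      using that bspec[OF max, of J] M(2) ideal.one_imp_carrier[of J R] by blast
  qed
  then show ?thesis using M(2) by (rule that)
qed

section \<open>Congruences modulo an ideal, written \<open>x \<ominus> y \<in> L\<close>\<close>

lemma ideal_minus_closed:
  assumes "ideal L R" "x \<in> L" "y \<in> L"
  shows "x \<ominus> y \<in> L"
  using assms
  by (simp add: a_minus_def additive_subgroup.a_closed additive_subgroup.a_inv_closed ideal.axioms(1))

lemma ideal_cong_refl:
  assumes "ideal L R" "x \<in> carrier R"
  shows "x \<ominus> x \<in> L"
proof -
  have "x \<ominus> x = \<zero>"
    using assms(2) by algebra
  then show ?thesis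
    using assms(1) by (simp only: additive_subgroup.zero_closed[OF ideal.axioms(1)])
qed

lemma ideal_cong_mem_iff:
  assumes L: "ideal L R" and c: "x \<in> carrier R" "y \<in> carrier R" and d: "x \<ominus> y \<in> L"
  shows "x \<in> L \<longleftrightarrow> y \<in> L"
proof -
  interpret L: ideal L R by fact
  have "x = (x \<ominus> y) \<oplus> y" "y = x \<ominus> (x \<ominus> y)"
    using c by algebra+
  then show ?thesis
    using L.a_closed ideal_minus_closed[OF L] d by metis
qed

lemma ideal_cong_trans:
  assumes L: "ideal L R"
    and c: "x \<in> carrier R" "y \<in> carrier R" "z \<in> carrier R"
    and d: "x \<ominus> y \<in> L" "y \<ominus> z \<in> L"
  shows "x \<ominus> z \<in> L"
proof -
  have "x \<ominus> z = (x \<ominus> y) \<oplus> (y \<ominus> z)"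
    using c by algebra
  then show ?thesis
    using d additive_subgroup.a_closed[OF ideal.axioms(1)[OF L]] by metis
qed

lemma ideal_cong_mult:
  assumes L: "ideal L R"
    and c: "x \<in> carrier R" "y \<in> carrier R" "x' \<in> carrier R" "y' \<in> carrier R"
    and d: "x \<ominus> x' \<in> L" "y \<ominus> y' \<in> L"
  shows "x \<otimes> y \<ominus> x' \<otimes> y' \<in> L"
proof -
  interpret L: ideal L R by fact
  have "x \<otimes> y \<ominus> x' \<otimes> y' = (x \<ominus> x') \<otimes> y \<oplus> x' \<otimes> (y \<ominus> y')"
    using c by algebra
  then show ?thesis
    using d c by (simp add: L.I_l_closed L.I_r_closed)
qed

lemma ideal_cong_finprod:
  assumes L: "ideal L R" and "finite T"
    and "\<And>i. i \<in> T \<Longrightarrow> f i \<in> carrier R" "\<And>i. i \<in> T \<Longrightarrow> g i \<in> carrier R"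
    and "\<And>i. i \<in> T \<Longrightarrow> f i \<ominus> g i \<in> L"
  shows "(\<Otimes>i\<in>T. f i) \<ominus> (\<Otimes>i\<in>T. g i) \<in> L"
  using assms(2-)
proof (induction T)
  case empty
  then show ?case
    using ideal_cong_refl[OF L one_closed] by simp
next
  case (insert a T)
  have "f a \<otimes> (\<Otimes>i\<in>T. f i) \<ominus> g a \<otimes> (\<Otimes>i\<in>T. g i) \<in> L"
    by (rule ideal_cong_mult[OF L]) (use insert in \<open>auto intro!: finprod_closed\<close>)
  then show ?case
    using insert by (simp add: Pi_iff)
qed

lemma ideal_finsum_closed:
  assumes L: "ideal L R" and "finite T" and "\<And>i. i \<in> T \<Longrightarrow> f i \<in> L"
  shows "(\<Oplus>i\<in>T. f i) \<in> L"
  using assms(2-)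
proof (induction T)
  case empty
  then show ?case
    using additive_subgroup.zero_closed[OF ideal.axioms(1)[OF L]] by simp
next
  case (insert a T)
  then show ?case
    using ideal.Icarr[OF L] additive_subgroup.a_closed[OF ideal.axioms(1)[OF L]]
    by (simp add: Pi_iff)
qed

lemma finsum_minus_distrib:
  assumes "f \<in> T \<rightarrow> carrier R" "g \<in> T \<rightarrow> carrier R"
  shows "(\<Oplus>i\<in>T. f i \<ominus> g i) = (\<Oplus>i\<in>T. f i) \<ominus> (\<Oplus>i\<in>T. g i)"
proof -
  have g: "(\<lambda>i. \<ominus> g i) \<in> T \<rightarrow> carrier R" using assms by auto
  have "(\<Oplus>i\<in>T. \<ominus> g i) = (\<Oplus>i\<in>T. (\<ominus> \<one>) \<otimes> g i)"
    by (rule finsum_cong') (use assms in \<open>auto simp: l_minus Pi_iff\<close>)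
  \<comment> \<open>For infinite \<open>T\<close> both sums are \<open>\<zero>\<close> by
    convention.\<close>
  also have "\<dots> = \<ominus> (\<Oplus>i\<in>T. g i)"
    using assms by (cases "finite T") (simp_all add: finsum_rdistr[symmetric] l_minus)
  finally show ?thesis
    using assms g by (simp add: a_minus_def finsum_addf)
qed

lemma ideal_cong_finsum:
  assumes L: "ideal L R" and fin: "finite T"
    and f: "\<And>i. i \<in> T \<Longrightarrow> f i \<in> carrier R" and g: "\<And>i. i \<in> T \<Longrightarrow> g i \<in> carrier R"
    and d: "\<And>i. i \<in> T \<Longrightarrow> f i \<ominus> g i \<in> L"
  shows "(\<Oplus>i\<in>T. f i) \<ominus> (\<Oplus>i\<in>T. g i) \<in> L"
proof -
  have "(\<Oplus>i\<in>T. f i \<ominus> g i) \<in> L"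
    by (rule ideal_finsum_closed[OF L fin d])
  then show ?thesis
    using finsum_minus_distrib[of f T g] f g by (simp add: Pi_iff)
qed

section \<open>Families that generate the unit ideal\<close>

text \<open>A proper ideal lies in a maximal one, so unitality can be tested and repaired at one
  maximal ideal at a time.\<close>

lemma genideal_eq_carrier_iff_maximal:
  assumes "S \<subseteq> carrier R"
  shows "Idl S = carrier R \<longleftrightarrow> (\<forall>M. maximalideal M R \<longrightarrow> \<not> S \<subseteq> M)"
proof
  assume S: "Idl S = carrier R"
  show "\<forall>M. maximalideal M R \<longrightarrow> \<not> S \<subseteq> M"
  proof (intro allI impI notI)
    fix M assume M: "maximalideal M R" and "S \<subseteq> M"
    then have "carrier R \<subseteq> M"
      using genideal_minimal[of M S] S maximalideal.axioms(1) by blast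
    then show False
      using M maximalideal.I_notcarr[OF M] ideal.Icarr[OF maximalideal.axioms(1)[OF M]] by blast
  qed
next
  assume *: "\<forall>M. maximalideal M R \<longrightarrow> \<not> S \<subseteq> M"
  show "Idl S = carrier R"
  proof (rule ccontr)
    assume "Idl S \<noteq> carrier R"
    then obtain M where "maximalideal M R" "Idl S \<subseteq> M"
      using obtain_maximalideal genideal_ideal[OF assms] by metis
    then show False
      using * genideal_self[OF assms] by blast
  qed
qed

text \<open>The linear combinations of the family form an ideal \<open>?S\<close> containing it, so
  the generated ideal is inside \<open>?S\<close>. This turns unitality into explicit
  coefficients.\<close>

lemma genideal_image_eq_carrier_iff:
  assumes fin: "finite T" and a: "\<And>j. j \<in> T \<Longrightarrow> a j \<in> carrier R"
  shows "Idl (a ` T) = carrier R \<longleftrightarrow> (\<exists>d \<in> T \<rightarrow> carrier R. (\<Oplus>j\<in>T. a j \<otimes> d j) = \<one>)"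
proof
  let ?S = "{\<Oplus>j\<in>T. a j \<otimes> d j | d. d \<in> T \<rightarrow> carrier R}"
  have aT: "a \<in> T \<rightarrow> carrier R" using a by auto
  have ideal: "ideal ?S R"
  proof (rule idealI[OF ring_axioms])
    show "subgroup ?S (add_monoid R)"
    proof (rule add.subgroupI)
      show "?S \<subseteq> carrier R" using a by (auto intro!: finsum_closed simp: Pi_iff)
      show "?S \<noteq> {}" by auto
    next
      fix x assume "x \<in> ?S"
      then obtain d where d: "d \<in> T \<rightarrow> carrier R" "x = (\<Oplus>j\<in>T. a j \<otimes> d j)" by blast
      have "\<ominus> x = (\<Oplus>j\<in>T. \<zero> \<ominus> a j \<otimes> d j)"
        using d a by (subst finsum_minus_distrib) (auto simp: Pi_iff a_minus_def finsum_zero)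
      also have "\<dots> = (\<Oplus>j\<in>T. a j \<otimes> (\<ominus> d j))"
        using d a by (intro finsum_cong') (auto simp: Pi_iff a_minus_def r_minus)
      finally show "\<ominus> x \<in> ?S" using d by (auto intro!: exI[of _ "\<lambda>j. \<ominus> d j"])
    next
      fix x y assume "x \<in> ?S" "y \<in> ?S"
      then obtain d e where d: "d \<in> T \<rightarrow> carrier R" "x = (\<Oplus>j\<in>T. a j \<otimes> d j)"
        and e: "e \<in> T \<rightarrow> carrier R" "y = (\<Oplus>j\<in>T. a j \<otimes> e j)" by blast
      have "x \<oplus> y = (\<Oplus>j\<in>T. a j \<otimes> d j \<oplus> a j \<otimes> e j)"
        using d e a by (simp add: finsum_addf Pi_iff)
      also have "\<dots> = (\<Oplus>j\<in>T. a j \<otimes> (d j \<oplus> e j))"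
        using d e a by (intro finsum_cong') (auto simp: Pi_iff r_distr)
      finally show "x \<oplus> y \<in> ?S" using d e by (auto intro!: exI[of _ "\<lambda>j. d j \<oplus> e j"])
    qed
  next
    fix x y assume "x \<in> ?S" and y: "y \<in> carrier R"
    then obtain d where d: "d \<in> T \<rightarrow> carrier R" "x = (\<Oplus>j\<in>T. a j \<otimes> d j)" by blast
    have "x \<otimes> y = (\<Oplus>j\<in>T. a j \<otimes> d j \<otimes> y)"
      using d a fin y by (simp add: finsum_ldistr Pi_iff)
    also have "\<dots> = (\<Oplus>j\<in>T. a j \<otimes> (d j \<otimes> y))"
      using d a y by (intro finsum_cong') (auto simp: Pi_iff m_assoc)
    finally show xy: "x \<otimes> y \<in> ?S" using d y by (auto intro!: exI[of _ "\<lambda>j. d j \<otimes> y"])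
    have "x \<in> carrier R" using d a by (auto intro!: finsum_closed simp: Pi_iff)
    then show "y \<otimes> x \<in> ?S" using xy y m_comm by simp
  qed
  have sub: "a ` T \<subseteq> ?S"
  proof
    fix x assume "x \<in> a ` T"
    then obtain j where j: "j \<in> T" "x = a j" by blast
    \<comment> \<open>Kronecker delta coefficients pick out the single generator
      \<open>a j\<close>.\<close>
    have "(\<Oplus>i\<in>T. a i \<otimes> (if i = j then \<one> else \<zero>)) = (\<Oplus>i\<in>T. if j = i then a i else \<zero>)"
      using a by (intro finsum_cong') auto
    also have "\<dots> = a j"
      using finsum_singleton[OF j(1) fin aT] .
    finally show "x \<in> ?S" using j by (auto intro!: exI[of _ "\<lambda>i. if i = j then \<one> else \<zero>"])
  qed
  assume "Idl (a ` T) = carrier R"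
  then have "\<one> \<in> ?S" using genideal_minimal[OF ideal sub] by blast
  then show "\<exists>d \<in> T \<rightarrow> carrier R. (\<Oplus>j\<in>T. a j \<otimes> d j) = \<one>" by force
next
  assume "\<exists>d \<in> T \<rightarrow> carrier R. (\<Oplus>j\<in>T. a j \<otimes> d j) = \<one>"
  then obtain d where d: "d \<in> T \<rightarrow> carrier R" "(\<Oplus>j\<in>T. a j \<otimes> d j) = \<one>" by blast
  have aT: "a ` T \<subseteq> carrier R" using a by auto
  interpret I: ideal "Idl (a ` T)" R by (rule genideal_ideal[OF aT])
  have "(\<Oplus>j\<in>T. a j \<otimes> d j) \<in> Idl (a ` T)"
  proof (rule ideal_finsum_closed[OF I.ideal_axioms fin])
    show "a j \<otimes> d j \<in> Idl (a ` T)" if "j \<in> T" for j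
      by (rule I.I_r_closed) (use genideal_self[OF aT] d(1) that in auto)
  qed
  then show "Idl (a ` T) = carrier R" using d(2) I.one_imp_carrier by simp
qed

section \<open>Comaximal ideals and Chinese remaindering\<close>

lemma set_add_eq_carrier_obtain:
  assumes K: "ideal K R" and L: "ideal L R" and "K <+>\<^bsub>R\<^esub> L = carrier R"
  obtains s where "s \<in> K" "\<one> \<ominus> s \<in> L"
proof -
  have "\<one> \<in> K <+>\<^bsub>R\<^esub> L" using assms by simp
  then obtain x y where xy: "x \<in> K" "y \<in> L" "\<one> = x \<oplus> y"
    by (auto simp: set_add_def')
  have "\<one> \<ominus> x = y"
    unfolding xy(3) using xy(1,2) ideal.Icarr[OF K] ideal.Icarr[OF L] by algebra
  then show ?thesis using xy that by blast
qed

lemma maximalideal_comaximal: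
  assumes M: "maximalideal M R" and K: "ideal K R" and "\<not> K \<subseteq> M"
  shows "K <+>\<^bsub>R\<^esub> M = carrier R"
proof -
  have M': "ideal M R" using M by (rule maximalideal.axioms(1))
  have eq: "K <+>\<^bsub>R\<^esub> M = Idl (K \<union> M)" using union_genideal[OF K M'] by simp
  have sub: "K \<union> M \<subseteq> carrier R" using ideal.Icarr[OF K] ideal.Icarr[OF M'] by blast
  have "K <+>\<^bsub>R\<^esub> M \<noteq> M" using assms(3) genideal_self[OF sub] eq by blast
  moreover have "M \<subseteq> K <+>\<^bsub>R\<^esub> M" using genideal_self[OF sub] eq by blast
  moreover have "ideal (K <+>\<^bsub>R\<^esub> M) R" by (rule add_ideals[OF K M'])
  moreover have "K <+>\<^bsub>R\<^esub> M \<subseteq> carrier R" using ideal.Icarr[OF add_ideals[OF K M']] by blast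
  ultimately show ?thesis using maximalideal.I_maximal[OF M, of "K <+>\<^bsub>R\<^esub> M"] by blast
qed

lemma comaximal_family:
  assumes K: "ideal K R" and "finite F" and "\<And>L. L \<in> F \<Longrightarrow> ideal L R"
    and "\<And>L. L \<in> F \<Longrightarrow> K <+>\<^bsub>R\<^esub> L = carrier R"
  shows "\<exists>s\<in>K. \<forall>L\<in>F. \<one> \<ominus> s \<in> L"
  using assms(2-)
proof (induction F)
  case empty
  then show ?case
    using additive_subgroup.zero_closed[OF ideal.axioms(1)[OF K]] by blast
next
  case (insert L F)
  interpret K: ideal K R by fact
  interpret L: ideal L R using insert.prems by simp
  have "\<exists>s\<in>K. \<forall>L\<in>F. \<one> \<ominus> s \<in> L"
    by (rule insert.IH) (use insert.prems in auto)
  then obtain s where s: "s \<in> K" "\<forall>L\<in>F. \<one> \<ominus> s \<in> L"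
    by blast
  obtain t where t: "t \<in> K" "\<one> \<ominus> t \<in> L"
    by (rule set_add_eq_carrier_obtain[OF K L.ideal_axioms]) (use insert.prems in auto)
  have c: "s \<in> carrier R" "t \<in> carrier R" using s t by auto
  \<comment> \<open>The new witness is chosen so that its complement is the product of the two
    complements: the factor \<open>\<one> \<ominus> s\<close> handles the members of
    \<open>F\<close>, the factor \<open>\<one> \<ominus> t\<close> handles \<open>L\<close>.\<close>
  have eq: "\<one> \<ominus> (s \<oplus> t \<otimes> (\<one> \<ominus> s)) = (\<one> \<ominus> s) \<otimes> (\<one> \<ominus> t)"
    using c by algebra
  show ?case
  proof (intro bexI ballI)
    show "s \<oplus> t \<otimes> (\<one> \<ominus> s) \<in> K"
      using s t c by (simp add: K.a_closed K.I_r_closed)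
    show "\<one> \<ominus> (s \<oplus> t \<otimes> (\<one> \<ominus> s)) \<in> L'" if "L' \<in> insert L F" for L'
      unfolding eq using that
    proof
      assume "L' = L"
      then show "(\<one> \<ominus> s) \<otimes> (\<one> \<ominus> t) \<in> L'"
        using t(2) c by (simp add: L.I_l_closed)
    next
      assume L': "L' \<in> F"
      have "ideal L' R" using L' insert.prems by simp
      then show "(\<one> \<ominus> s) \<otimes> (\<one> \<ominus> t) \<in> L'"
        using L' s(2) c by (simp add: ideal.I_r_closed)
    qed
  qed
qed

text \<open>Each \<open>K \<in> F\<close> has an element congruent to \<open>1\<close> modulo all of
  \<open>G\<close>; the product of these elements lies in every \<open>K\<close> and is still
  \<open>1\<close> modulo \<open>G\<close>.\<close>

lemma comaximal_families:
  assumes "finite F" "finite G" and G: "\<And>L. L \<in> G \<Longrightarrow> ideal L R" and "\<And>K. K \<in> F \<Longrightarrow> ideal K R"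
    and "\<And>K L. K \<in> F \<Longrightarrow> L \<in> G \<Longrightarrow> K <+>\<^bsub>R\<^esub> L = carrier R"
  shows "\<exists>s\<in>carrier R. (\<forall>K\<in>F. s \<in> K) \<and> (\<forall>L\<in>G. \<one> \<ominus> s \<in> L)"
  using assms(1,4-)
proof (induction F)
  case empty
  show ?case
    by (auto intro!: bexI[of _ \<one>] simp: ideal_cong_refl G)
next
  case (insert K F)
  interpret K: ideal K R using insert.prems by simp
  have "\<exists>s\<in>carrier R. (\<forall>K\<in>F. s \<in> K) \<and> (\<forall>L\<in>G. \<one> \<ominus> s \<in> L)"
    by (rule insert.IH) (use insert.prems in auto)
  then obtain s where s: "s \<in> carrier R" "\<forall>K\<in>F. s \<in> K" "\<forall>L\<in>G. \<one> \<ominus> s \<in> L"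
    by blast
  have "\<exists>t\<in>K. \<forall>L\<in>G. \<one> \<ominus> t \<in> L"
    by (rule comaximal_family[OF K.ideal_axioms assms(2) G]) (use insert.prems in auto)
  then obtain t where t: "t \<in> K" "\<forall>L\<in>G. \<one> \<ominus> t \<in> L"
    by blast
  have tc: "t \<in> carrier R" using t(1) by simp
  have eq: "\<one> \<ominus> s \<otimes> t = (\<one> \<ominus> s) \<oplus> s \<otimes> (\<one> \<ominus> t)"
    using s(1) tc by algebra
  show ?case
  proof (intro bexI conjI ballI)
    show "s \<otimes> t \<in> K'" if "K' \<in> insert K F" for K'
      using that
    proof
      assume "K' = K"
      then show "s \<otimes> t \<in> K'"
        using t(1) s(1) by (simp add: K.I_l_closed)
    next
      assume K': "K' \<in> F"
      have "ideal K' R" using K' insert.prems by simp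
      then show "s \<otimes> t \<in> K'"
        using K' s(2) tc by (simp add: ideal.I_r_closed)
    qed
    show "\<one> \<ominus> s \<otimes> t \<in> L" if "L \<in> G" for L
      unfolding eq using s(1) s(3) t(2) that
      by (simp add: G additive_subgroup.a_closed ideal.axioms(1) ideal.I_l_closed)
    show "s \<otimes> t \<in> carrier R" using s(1) tc by simp
  qed
qed

section \<open>Making the column products of some rows unital within given congruences\<close>

text \<open>Above a member of \<open>F\<close>, the condition \<open>local\<close> survives every
  change within the congruences. The other maximal ideals are comaximal to all of \<open>F\<close>,
  so entries can be adjusted at finitely many of them at once. Column \<open>0\<close> leaves only
  finitely many bad ones, and column \<open>1\<close> repairs those.\<close>

lemma lift_rows_to_unital:
  fixes k :: nat
  assumes fin: "\<And>x. x \<in> carrier R \<Longrightarrow> x \<noteq> \<zero> \<Longrightarrow> finite {M. maximalideal M R \<and> x \<in> M}"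
    and F: "finite F" "\<And>L. L \<in> F \<Longrightarrow> ideal L R"
    and T: "finite T" and k: "k \<ge> 2"
    and A: "\<And>i j. i \<in> T \<Longrightarrow> j < k \<Longrightarrow> A i j \<in> carrier R"
    and local: "\<And>L M. L \<in> F \<Longrightarrow> maximalideal M R \<Longrightarrow> L \<subseteq> M \<Longrightarrow> \<exists>j<k. (\<Otimes>i\<in>T. A i j) \<notin> M"
  obtains B where "\<And>i j. i \<in> T \<Longrightarrow> j < k \<Longrightarrow> B i j \<in> carrier R"
    "\<And>i j L. i \<in> T \<Longrightarrow> j < k \<Longrightarrow> L \<in> F \<Longrightarrow> B i j \<ominus> A i j \<in> L"
    "Idl ((\<lambda>j. \<Otimes>i\<in>T. B i j) ` {..<k}) = carrier R"
proof (cases "\<exists>N. maximalideal N R \<and> (\<forall>L\<in>F. \<not> L \<subseteq> N)")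
  case False
  \<comment> \<open>Every maximal ideal lies above a member of \<open>F\<close>, so \<open>A\<close>
    itself works.\<close>
  have "Idl ((\<lambda>j. \<Otimes>i\<in>T. A i j) ` {..<k}) = carrier R"
  proof (subst genideal_eq_carrier_iff_maximal)
    show "(\<lambda>j. \<Otimes>i\<in>T. A i j) ` {..<k} \<subseteq> carrier R"
      using A by (auto intro!: finprod_closed)
    show "\<forall>M. maximalideal M R \<longrightarrow> \<not> (\<lambda>j. \<Otimes>i\<in>T. A i j) ` {..<k} \<subseteq> M"
    proof (intro allI impI)
      fix M assume M: "maximalideal M R"
      then obtain L where "L \<in> F" "L \<subseteq> M" using False by blast
      then obtain j where "j < k" "(\<Otimes>i\<in>T. A i j) \<notin> M" using local M by blast
      then show "\<not> (\<lambda>j. \<Otimes>i\<in>T. A i j) ` {..<k} \<subseteq> M" by auto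
    qed
  qed
  moreover have "A i j \<ominus> A i j \<in> L" if "i \<in> T" "j < k" "L \<in> F" for i j L
    using ideal_cong_refl F(2) A that by blast
  ultimately show ?thesis by (intro that[of A] A)
next
  case True
  then obtain N where N: "maximalideal N R" "\<And>L. L \<in> F \<Longrightarrow> \<not> L \<subseteq> N" by blast
  have idl: "ideal M R" if "maximalideal M R" for M
    using that by (rule maximalideal.axioms(1))
  have one: "\<one> \<notin> M" if M: "maximalideal M R" for M
    using ideal.one_imp_carrier[OF idl[OF M]] maximalideal.I_notcarr[OF M] by blast
  have "\<exists>t\<in>carrier R. (\<forall>L\<in>F. t \<in> L) \<and> (\<forall>N'\<in>{N}. \<one> \<ominus> t \<in> N')"
    by (rule comaximal_families) (use F N idl maximalideal_comaximal[OF N(1)] in auto)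
  then obtain t where t: "t \<in> carrier R" "\<forall>L\<in>F. t \<in> L" "\<one> \<ominus> t \<in> N"
    by blast
  \<comment> \<open>\<open>p\<close> is the product of column \<open>0\<close> after the change by
    \<open>t\<close>. The ideal \<open>N\<close> serves to make \<open>p\<close> nonzero, since
    \<open>fin\<close> gives finiteness for nonzero elements only.\<close>
  define p where "p = (\<Otimes>i\<in>T. A i 0 \<oplus> t \<otimes> (\<one> \<ominus> A i 0))"
  have A0: "A i 0 \<in> carrier R" if "i \<in> T" for i using A[OF that] k by simp
  have p: "p \<in> carrier R"
    unfolding p_def using A0 t(1) by (intro finprod_closed) auto
  \<comment> \<open>Used with \<open>t\<close> at \<open>N\<close> in column \<open>0\<close> and
    with \<open>s\<close> at the members of \<open>?S\<close> in column \<open>1\<close>.\<close>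
  have cong_one: "(\<Otimes>i\<in>T. f i \<oplus> s \<otimes> (\<one> \<ominus> f i)) \<notin> M"
    if M: "maximalideal M R" and f: "\<And>i. i \<in> T \<Longrightarrow> f i \<in> carrier R"
      and s: "s \<in> carrier R" "\<one> \<ominus> s \<in> M" for M f s
  proof -
    have c: "(\<Otimes>i\<in>T. f i \<oplus> s \<otimes> (\<one> \<ominus> f i)) \<in> carrier R"
      using f s by (intro finprod_closed) auto
    have "(\<Otimes>i\<in>T. f i \<oplus> s \<otimes> (\<one> \<ominus> f i)) \<ominus> (\<Otimes>i\<in>T. \<one>) \<in> M"
    proof (rule ideal_cong_finprod[OF idl[OF M] T])
      fix i assume i: "i \<in> T"
      have "f i \<oplus> s \<otimes> (\<one> \<ominus> f i) \<ominus> \<one> = (f i \<ominus> \<one>) \<otimes> (\<one> \<ominus> s)"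
        using f[OF i] s(1) by algebra
      then show "f i \<oplus> s \<otimes> (\<one> \<ominus> f i) \<ominus> \<one> \<in> M"
        using ideal.I_l_closed[OF idl[OF M] s(2), of "f i \<ominus> \<one>"] f[OF i] by simp
    qed (use f s in auto)
    then show ?thesis
      using ideal_cong_mem_iff[OF idl[OF M] c one_closed] one[OF M] by simp
  qed
  have "p \<notin> N"
    unfolding p_def by (rule cong_one[OF N(1) A0 t(1,3)])
  then have "p \<noteq> \<zero>"
    using additive_subgroup.zero_closed[OF ideal.axioms(1)[OF idl[OF N(1)]]] by auto
  then have "finite {M. maximalideal M R \<and> p \<in> M}" using fin p by blast
  \<comment> \<open>These are the maximal ideals at which neither \<open>local\<close> nor column
    \<open>0\<close> guarantees a product outside.\<close>
  let ?S = "{M. maximalideal M R \<and> p \<in> M \<and> (\<forall>L\<in>F. \<not> L \<subseteq> M)}"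
  have "finite ?S"
    by (rule rev_finite_subset[OF \<open>finite {M. maximalideal M R \<and> p \<in> M}\<close>]) auto
  then have "\<exists>s\<in>carrier R. (\<forall>L\<in>F. s \<in> L) \<and> (\<forall>M\<in>?S. \<one> \<ominus> s \<in> M)"
    by (rule comaximal_families[OF F(1)]) (use F(2) idl maximalideal_comaximal in auto)
  then obtain s where s: "s \<in> carrier R" "\<forall>L\<in>F. s \<in> L" "\<forall>M\<in>?S. \<one> \<ominus> s \<in> M"
    by blast
  \<comment> \<open>Adding \<open>x (1 - A i j)\<close> changes nothing modulo the ideals in \<open>F\<close> but replaces the entry by \<open>1\<close>
    wherever \<open>x \<equiv> 1\<close>: modulo \<open>N\<close> in column \<open>0\<close>, modulo the ideals in \<open>?S\<close> in column \<open>1\<close>.\<close>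
  define u where "u j = (if j = 0 then t else if j = 1 then s else \<zero>)" for j :: nat
  define B where "B i j = A i j \<oplus> u j \<otimes> (\<one> \<ominus> A i j)" for i j
  have u: "u j \<in> carrier R" for j using t s by (simp add: u_def)
  have uL: "u j \<in> L" if "L \<in> F" for j L
    using t s that additive_subgroup.zero_closed[OF ideal.axioms(1)[OF F(2)[OF that]]]
    by (simp add: u_def)
  have B: "B i j \<in> carrier R" if "i \<in> T" "j < k" for i j
    using A[OF that] u by (simp add: B_def)
  have BA: "B i j \<ominus> A i j \<in> L" if ij: "i \<in> T" "j < k" and L: "L \<in> F" for i j L
  proof -
    have "B i j \<ominus> A i j = u j \<otimes> (\<one> \<ominus> A i j)"
      using A[OF ij] u[of j] unfolding B_def by algebra
    then show ?thesis
      using ideal.I_r_closed[OF F(2)[OF L] uL[OF L]] A[OF ij] by simp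
  qed
  \<comment> \<open>The column depends on \<open>M\<close>: the one given by \<open>local\<close> if
    \<open>M\<close> is above a member of \<open>F\<close>, otherwise column \<open>1\<close> if
    \<open>p \<in> M\<close> and column \<open>0\<close> if not.\<close>
  have "\<exists>j<k. (\<Otimes>i\<in>T. B i j) \<notin> M" if M: "maximalideal M R" for M
  proof (cases "\<exists>L\<in>F. L \<subseteq> M")
    case True
    then obtain L where L: "L \<in> F" "L \<subseteq> M" by blast
    obtain j where j: "j < k" "(\<Otimes>i\<in>T. A i j) \<notin> M" using local[OF L(1) M L(2)] by blast
    have "(\<Otimes>i\<in>T. B i j) \<ominus> (\<Otimes>i\<in>T. A i j) \<in> M"
      by (rule subsetD[OF L(2)], rule ideal_cong_finprod[OF F(2)[OF L(1)] T]) (use A B BA L j in auto)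
    then have "(\<Otimes>i\<in>T. B i j) \<notin> M"
      using j A B by (subst ideal_cong_mem_iff[OF idl[OF M], of _ "\<Otimes>i\<in>T. A i j"])
        (auto intro!: finprod_closed)
    then show ?thesis using j by blast
  next
    case False
    show ?thesis
    proof (cases "p \<in> M")
      case True
      have "(\<Otimes>i\<in>T. B i 1) \<notin> M"
        unfolding B_def u_def using A k s M True False
        by (simp, intro cong_one[OF M]) auto
      then show ?thesis using k by (intro exI[of _ 1]) auto
    next
      case False
      then have "(\<Otimes>i\<in>T. B i 0) \<notin> M"
        by (simp add: B_def u_def p_def)
      then show ?thesis using k by (intro exI[of _ 0]) auto
    qed
  qed
  moreover have "(\<lambda>j. \<Otimes>i\<in>T. B i j) ` {..<k} \<subseteq> carrier R"
    using B by (auto intro!: finprod_closed)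
  ultimately have "Idl ((\<lambda>j. \<Otimes>i\<in>T. B i j) ` {..<k}) = carrier R"
    by (subst genideal_eq_carrier_iff_maximal) (auto simp: image_subset_iff)
  then show ?thesis by (intro that[of B] B BA)
qed

section \<open>A matrix with rows prescribed modulo the ideals\<close>

lemma exists_matrix_congruent_rows:
  fixes r k :: nat
  assumes fin: "\<And>x. x \<in> carrier R \<Longrightarrow> x \<noteq> \<zero> \<Longrightarrow> finite {M. maximalideal M R \<and> x \<in> M}"
    and r: "r \<ge> 2" and k: "k \<ge> 2"
    and I: "\<And>i. i < r \<Longrightarrow> ideal (I i) R"
    and comax: "\<And>i j. i < r \<Longrightarrow> j < r \<Longrightarrow> i \<noteq> j \<Longrightarrow> I i <+>\<^bsub>R\<^esub> I j = carrier R"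
    and b: "\<And>i j. i < r \<Longrightarrow> j < k \<Longrightarrow> b i j \<in> carrier R"
    and unital: "\<And>i. i < r \<Longrightarrow> Idl (b i ` {..<k}) = carrier R"
  shows "\<exists>A. (\<forall>i<r. \<forall>j<k. A i j \<in> carrier R \<and> A i j \<ominus> b i j \<in> I i) \<and>
    (\<Oplus>j\<in>{..<k}. \<Otimes>i\<in>{..<r}. A i j) = \<one>"
proof -
  define m where "m = r - 1"
  have m: "r = Suc m" "m \<ge> 1" using r by (auto simp: m_def)
  \<comment> \<open>The \<open>e i\<close> are the Chinese remainder elements: \<open>1\<close>
    modulo \<open>I i\<close> and \<open>0\<close> modulo the other ideals.
    \<open>comaximal_family\<close> gives the opposite pattern, whence the complement
    \<open>\<one> \<ominus> s\<close>.\<close>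
  have e_ex: "\<exists>e\<in>carrier R. \<one> \<ominus> e \<in> I i \<and> (\<forall>l<r. l \<noteq> i \<longrightarrow> e \<in> I l)" if i: "i < r" for i
  proof -
    have "\<exists>s\<in>I i. \<forall>L\<in>I ` ({..<r} - {i}). \<one> \<ominus> s \<in> L"
      by (rule comaximal_family[OF I[OF i]]) (use I comax i in auto)
    then obtain s where s: "s \<in> I i" "\<forall>L\<in>I ` ({..<r} - {i}). \<one> \<ominus> s \<in> L"
      by blast
    have c: "s \<in> carrier R" using s(1) ideal.Icarr[OF I[OF i]] by blast
    have "\<one> \<ominus> (\<one> \<ominus> s) = s" using c by algebra
    then show ?thesis
      using s c by (intro bexI[of _ "\<one> \<ominus> s"]) auto
  qed
  define e where "e i = (SOME x. x \<in> carrier R \<and> \<one> \<ominus> x \<in> I i \<and> (\<forall>l<r. l \<noteq> i \<longrightarrow> x \<in> I l))" for i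
  have "e i \<in> carrier R \<and> \<one> \<ominus> e i \<in> I i \<and> (\<forall>l<r. l \<noteq> i \<longrightarrow> e i \<in> I l)" if "i < r" for i
    unfolding e_def by (rule someI_ex) (use e_ex[OF that] in blast)
  then have e: "\<And>i. i < r \<Longrightarrow> e i \<in> carrier R" "\<And>i. i < r \<Longrightarrow> \<one> \<ominus> e i \<in> I i"
    "\<And>i l. i < r \<Longrightarrow> l < r \<Longrightarrow> l \<noteq> i \<Longrightarrow> e i \<in> I l"
    by auto
  \<comment> \<open>\<open>d\<close> is the column product to aim for modulo \<open>I m\<close>:
    paired with the last row \<open>b m\<close>, it gives sum \<open>1\<close>.\<close>
  obtain d where dP: "d \<in> {..<k} \<rightarrow> carrier R" and bd: "(\<Oplus>j\<in>{..<k}. b m j \<otimes> d j) = \<one>"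
    using unital[of m] genideal_image_eq_carrier_iff[of "{..<k}" "b m"] b m by auto
  have d: "d j \<in> carrier R" if "j < k" for j using dP that by auto
  \<comment> \<open>\<open>q l\<close> is the pattern that the first \<open>m\<close> rows \<open>C\<close> realise modulo \<open>I l\<close>.\<close>
  define w where "w i j = (if i = 0 then \<one> \<oplus> e m \<otimes> (d j \<ominus> \<one>) else \<one>)" for i j :: nat
  \<comment> \<open>\<open>e i\<close> interpolates: \<open>C i j\<close> is \<open>b i j\<close>
    modulo \<open>I i\<close> and \<open>w i j\<close> modulo the other ideals. In row
    \<open>0\<close>, \<open>e m\<close> makes \<open>w\<close> equal to \<open>d j\<close> modulo
    \<open>I m\<close> and \<open>1\<close> modulo the others. That row is among the first
    \<open>m\<close> because \<open>r \<ge> 2\<close>.\<close>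
  define C where "C i j = w i j \<oplus> e i \<otimes> (b i j \<ominus> w i j)" for i j
  define q where "q l i j = (if l = m then if i = 0 then d j else \<one> else if i = l then b l j else \<one>)"
    for l i j
  have w: "w i j \<in> carrier R" if "j < k" for i j
    using e(1)[of m] d[OF that] m by (simp add: w_def)
  have C: "C i j \<in> carrier R" if "i < m" "j < k" for i j
    using e(1)[of i] w[OF that(2)] b[of i j] that m by (simp add: C_def)
  have q: "q l i j \<in> carrier R" if "j < k" "l < r" for l i j
    using d b that by (simp add: q_def)
  have Cq: "C i j \<ominus> q l i j \<in> I l" if ij: "i < m" "j < k" and l: "l < r" for i j l
  proof -
    have ec: "e i \<in> carrier R" "e m \<in> carrier R" and bc: "b i j \<in> carrier R"
      and wc: "w i j \<in> carrier R" and dc: "d j \<in> carrier R"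
      using e(1) b w d ij m by auto
    interpret L: ideal "I l" R by (rule I[OF l])
    show ?thesis
    proof (cases "i = l")
      case True
      have "C i j \<ominus> b i j = (\<one> \<ominus> e i) \<otimes> (w i j \<ominus> b i j)"
        unfolding C_def using ec bc wc by algebra
      then show ?thesis
        using True ij e(2)[OF l] bc wc by (simp add: q_def L.I_r_closed)
    next
      case False
      have "C i j \<ominus> w i j = e i \<otimes> (b i j \<ominus> w i j)"
        unfolding C_def using ec bc wc by algebra
      then have Cw: "C i j \<ominus> w i j \<in> I l"
        using e(3)[of i l] False l ij m bc wc by (simp add: L.I_r_closed)
      have "w i j \<ominus> q l i j \<in> I l"
      proof (cases "i = 0")
        case i0: True
        show ?thesis
        proof (cases "l = m")
          case True
          have "w 0 j \<ominus> d j = (\<one> \<ominus> e m) \<otimes> (\<one> \<ominus> d j)"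
            using ec dc by (simp add: w_def) algebra
          then show ?thesis
            using True i0 e(2)[OF l] dc L.I_r_closed[of "\<one> \<ominus> e m" "\<one> \<ominus> d j"] by (simp add: q_def)
        next
          case lm: False
          have "w 0 j \<ominus> \<one> = e m \<otimes> (d j \<ominus> \<one>)"
            using ec dc by (simp add: w_def) algebra
          then show ?thesis
            using lm False i0 e(3)[of m l] l m dc by (simp add: q_def L.I_r_closed)
        qed
      next
        case i0: False
        then show ?thesis
          using False ideal_cong_refl[OF I[OF l] one_closed] by (auto simp: q_def w_def)
      qed
      then show ?thesis
        using ideal_cong_trans[OF I[OF l], of "C i j" "w i j" "q l i j"] Cw C q w ij l by blast
    qed
  qed
  have prod_single: "(\<Otimes>i\<in>{..<m}. if i = l then x else \<one>) = x" if "l < m" "x \<in> carrier R" for l x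
    using finprod_singleton[of l "{..<m}" "\<lambda>_. x"] that
    by (simp add: eq_commute)
  \<comment> \<open>At most one row of each pattern differs from \<open>1\<close>.\<close>
  have q_prod: "(\<Otimes>i\<in>{..<m}. q l i j) = (if l = m then d j else b l j)" if "l < r" "j < k" for l j
    using prod_single[of l "b l j"] prod_single[of 0 "d j"] d b that m
    by (auto simp: q_def cong: if_cong)
  have loc: "\<exists>j<k. (\<Otimes>i\<in>{..<m}. C i j) \<notin> M"
    if L: "L \<in> I ` {..<r}" and M: "maximalideal M R" and LM: "L \<subseteq> M" for L M
  proof -
    obtain l where l: "l < r" "L = I l" using L by blast
    have "\<exists>j<k. (if l = m then d j else b l j) \<notin> M"
    proof (cases "l = m")
      case True
      \<comment> \<open>The relation \<open>bd\<close> is symmetric in \<open>b m\<close> and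
        \<open>d\<close>, so \<open>d\<close> is unital too, with coefficients
        \<open>b m\<close>.\<close>
      have "Idl (d ` {..<k}) = carrier R"
      proof (subst genideal_image_eq_carrier_iff)
        have "(\<Oplus>j\<in>{..<k}. d j \<otimes> b m j) = \<one>"
          unfolding bd[symmetric] using b d m by (intro finsum_cong') (auto simp: m_comm)
        then show "\<exists>d'\<in>{..<k} \<rightarrow> carrier R. (\<Oplus>j\<in>{..<k}. d j \<otimes> d' j) = \<one>"
          using b m by (intro bexI[of _ "b m"]) auto
      qed (use d in auto)
      then have "\<not> d ` {..<k} \<subseteq> M"
        using genideal_eq_carrier_iff_maximal[of "d ` {..<k}"] d M by blast
      then show ?thesis using True by auto
    next
      case False
      have "\<not> b l ` {..<k} \<subseteq> M"
        using genideal_eq_carrier_iff_maximal[of "b l ` {..<k}"] unital[OF l(1)] b[OF l(1)] M by blast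
      then show ?thesis using False by auto
    qed
    then obtain j where j: "j < k" "(\<Otimes>i\<in>{..<m}. q l i j) \<notin> M"
      using q_prod[OF l(1)] by auto
    have "(\<Otimes>i\<in>{..<m}. C i j) \<ominus> (\<Otimes>i\<in>{..<m}. q l i j) \<in> M"
      using ideal_cong_finprod[OF I[OF l(1)], of "{..<m}" "\<lambda>i. C i j" "\<lambda>i. q l i j"] C q Cq l j LM
      by auto
    then have "(\<Otimes>i\<in>{..<m}. C i j) \<notin> M"
      using j C q l
      by (subst ideal_cong_mem_iff[OF maximalideal.axioms(1)[OF M], of _ "\<Otimes>i\<in>{..<m}. q l i j"])
        (auto intro!: finprod_closed)
    then show ?thesis using j by blast
  qed
  \<comment> \<open>The family contains all \<open>r\<close> ideals, \<open>I m\<close> included, so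
    the products of the lifted rows remain \<open>d\<close> modulo \<open>I m\<close>.\<close>
  obtain B where B: "\<And>i j. i \<in> {..<m} \<Longrightarrow> j < k \<Longrightarrow> B i j \<in> carrier R"
    and BC: "\<And>i j L. i \<in> {..<m} \<Longrightarrow> j < k \<Longrightarrow> L \<in> I ` {..<r} \<Longrightarrow> B i j \<ominus> C i j \<in> L"
    and Bu: "Idl ((\<lambda>j. \<Otimes>i\<in>{..<m}. B i j) ` {..<k}) = carrier R"
    by (rule lift_rows_to_unital[of "I ` {..<r}" "{..<m}" k C, OF fin]) (use I C k loc in blast)+
  define p where "p j = (\<Otimes>i\<in>{..<m}. B i j)" for j
  have p: "p j \<in> carrier R" if "j < k" for j
    unfolding p_def using B that by (intro finprod_closed) auto
  have "Idl (p ` {..<k}) = carrier R"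
    using Bu by (simp add: p_def[abs_def])
  then obtain c where cP: "c \<in> {..<k} \<rightarrow> carrier R" and pc: "(\<Oplus>j\<in>{..<k}. p j \<otimes> c j) = \<one>"
    using genideal_image_eq_carrier_iff[of "{..<k}" p] p by auto
  have c: "c j \<in> carrier R" if "j < k" for j using cP that by auto
  have Bq: "B i j \<ominus> q l i j \<in> I l" if "i < m" "j < k" "l < r" for i j l
    using ideal_cong_trans[OF I[OF that(3)], of "B i j" "C i j" "q l i j"] B C q BC Cq that by blast
  have bm: "b m j \<in> carrier R" if "j < k" for j using b m that by simp
  \<comment> \<open>\<open>t\<close> is the error left by using \<open>b m\<close> as last row. It
    lies in \<open>I m\<close> because \<open>p\<close> is congruent to \<open>d\<close>
    there.\<close>
  define t where "t = (\<Oplus>j\<in>{..<k}. p j \<otimes> b m j) \<ominus> \<one>"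
  have pb: "(\<Oplus>j\<in>{..<k}. p j \<otimes> b m j) \<in> carrier R"
    using p b m by (intro finsum_closed) auto
  have t: "t \<in> carrier R" using pb by (simp add: t_def)
  have tI: "t \<in> I m"
  proof -
    have "p j \<ominus> d j \<in> I m" if j: "j < k" for j
      using ideal_cong_finprod[OF I, of m "{..<m}" "\<lambda>i. B i j" "\<lambda>i. q m i j"] B q Bq q_prod[of m j] j m
      by (simp add: p_def)
    moreover have "b m j \<ominus> b m j \<in> I m" if j: "j < k" for j
      using ideal_cong_refl[OF I] b j m by simp
    ultimately have "b m j \<otimes> p j \<ominus> b m j \<otimes> d j \<in> I m" if "j < k" for j
      using ideal_cong_mult[OF I[of m], of "b m j" "p j" "b m j" "d j"] b p d m that by auto
    then have "(\<Oplus>j\<in>{..<k}. b m j \<otimes> p j) \<ominus> (\<Oplus>j\<in>{..<k}. b m j \<otimes> d j) \<in> I m"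
      using ideal_cong_finsum[OF I[of m], of "{..<k}" "\<lambda>j. b m j \<otimes> p j" "\<lambda>j. b m j \<otimes> d j"] b p d m
      by auto
    moreover have "(\<Oplus>j\<in>{..<k}. b m j \<otimes> p j) = (\<Oplus>j\<in>{..<k}. p j \<otimes> b m j)"
      using b p m by (intro finsum_cong') (auto simp: m_comm)
    ultimately show ?thesis using bd by (simp add: t_def)
  qed
  \<comment> \<open>Since \<open>p\<close> pairs with \<open>c\<close> to \<open>1\<close>,
    subtracting \<open>t \<otimes> c j\<close> lowers the total by exactly \<open>t\<close>; since
    \<open>t \<in> I m\<close>, the last row keeps its residues.\<close>
  define A where "A i j = (if i = m then b m j \<ominus> t \<otimes> c j else B i j)" for i j
  have Ac: "A i j \<in> carrier R" if "i < r" "j < k" for i j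
    using B b t c that m by (simp add: A_def)
  have "A i j \<ominus> b i j \<in> I i" if ij: "i < r" "j < k" for i j
  proof (cases "i = m")
    case True
    have "b m j \<ominus> t \<otimes> c j \<ominus> b m j = (\<ominus> c j) \<otimes> t"
      using bm[OF ij(2)] t c[OF ij(2)] by algebra
    then show ?thesis
      using True ideal.I_l_closed[OF I tI, of "\<ominus> c j"] c ij m by (simp add: A_def)
  next
    case False
    then show ?thesis using Bq[of i j i] ij m by (simp add: A_def q_def)
  qed
  moreover have "(\<Oplus>j\<in>{..<k}. \<Otimes>i\<in>{..<r}. A i j) = \<one>"
  proof -
    have prod: "(\<Otimes>i\<in>{..<r}. A i j) = p j \<otimes> b m j \<ominus> t \<otimes> (p j \<otimes> c j)" if j: "j < k" for j
    proof -
      have "(\<Otimes>i\<in>{..<m}. A i j) = p j"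
        unfolding p_def using B j by (intro finprod_cong') (auto simp: A_def)
      moreover have "(\<Otimes>i\<in>{..<r}. A i j) = A m j \<otimes> (\<Otimes>i\<in>{..<m}. A i j)"
        using finprod_insert[of "{..<m}" m "\<lambda>i. A i j"] Ac j m by (simp add: lessThan_Suc)
      ultimately have "(\<Otimes>i\<in>{..<r}. A i j) = (b m j \<ominus> t \<otimes> c j) \<otimes> p j"
        by (simp add: A_def)
      also have "\<dots> = p j \<otimes> b m j \<ominus> t \<otimes> (p j \<otimes> c j)"
        using p[OF j] bm[OF j] t c[OF j] by algebra
      finally show ?thesis .
    qed
    have "(\<Oplus>j\<in>{..<k}. \<Otimes>i\<in>{..<r}. A i j) = (\<Oplus>j\<in>{..<k}. p j \<otimes> b m j \<ominus> t \<otimes> (p j \<otimes> c j))"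
      using prod p b t c m by (intro finsum_cong') auto
    also have "\<dots> = (\<Oplus>j\<in>{..<k}. p j \<otimes> b m j) \<ominus> t \<otimes> (\<Oplus>j\<in>{..<k}. p j \<otimes> c j)"
      using p b t c m by (simp add: finsum_minus_distrib finsum_rdistr Pi_iff)
    also have "\<dots> = \<one>"
    proof -
      have "x \<ominus> (x \<ominus> \<one>) \<otimes> \<one> = \<one>" if "x \<in> carrier R" for x
        using that by algebra
      then show ?thesis
        unfolding pc t_def using pb by blast
    qed
    finally show ?thesis .
  qed
  ultimately show ?thesis using Ac by (intro exI[of _ A]) simp
qed

section \<open>Unital tuples and the projective relation\<close>

lemma unital_tuplesD:
  assumes "a \<in> unital_tuples R n"
  shows "\<And>j. j \<le> n \<Longrightarrow> a j \<in> carrier R" "Idl (a ` {..n}) = carrier R"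
  using assms by (auto simp: unital_tuples_def)

text \<open>Multiply a relation expressing \<open>1\<close> through the \<open>a l\<close> by
  \<open>x\<close>. This replaces division by a nonzero coordinate in the proof of
  transitivity.\<close>

lemma unital_tuple_cancel:
  assumes L: "ideal L R" and a: "a \<in> unital_tuples R n" and x: "x \<in> carrier R"
    and ax: "\<And>l. l \<le> n \<Longrightarrow> a l \<otimes> x \<in> L"
  shows "x \<in> L"
proof -
  interpret L: ideal L R by fact
  obtain d where d: "d \<in> {..n} \<rightarrow> carrier R" "(\<Oplus>l\<in>{..n}. a l \<otimes> d l) = \<one>"
    using genideal_image_eq_carrier_iff[of "{..n}" a] unital_tuplesD[OF a] by auto
  have ac: "a l \<in> carrier R" "d l \<in> carrier R" if "l \<le> n" for l
    using unital_tuplesD(1)[OF a that] d(1) that by auto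
  have "x = (\<Oplus>l\<in>{..n}. a l \<otimes> d l) \<otimes> x"
    using d(2) x by simp
  also have "\<dots> = (\<Oplus>l\<in>{..n}. a l \<otimes> d l \<otimes> x)"
    using ac x by (intro finsum_ldistr) auto
  also have "\<dots> \<in> L"
  proof (rule ideal_finsum_closed[OF L])
    fix l assume l: "l \<in> {..n}"
    then have "a l \<otimes> d l \<otimes> x = d l \<otimes> (a l \<otimes> x)"
      using ac[of l] x by (simp add: m_ac)
    then show "a l \<otimes> d l \<otimes> x \<in> L"
      using ax[of l] l ac[of l] by (simp add: L.I_l_closed)
  qed simp
  finally show ?thesis .
qed

lemma proj_rel_iff:
  assumes L: "ideal L R"
  shows "(a, b) \<in> proj_rel R L n \<longleftrightarrow>
    a \<in> unital_tuples R n \<and> b \<in> unital_tuples R n \<and>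
    (\<forall>i\<le>n. \<forall>j\<le>n. a i \<otimes> b j \<ominus> a j \<otimes> b i \<in> L)"
proof
  assume ab: "(a, b) \<in> proj_rel R L n"
  then have u: "a \<in> unital_tuples R n" "b \<in> unital_tuples R n"
    and lt: "\<And>i j. i < j \<Longrightarrow> j \<le> n \<Longrightarrow> a i \<otimes> b j \<ominus> a j \<otimes> b i \<in> L"
    by (auto simp: proj_rel_def)
  note c = unital_tuplesD(1)[OF u(1)] unital_tuplesD(1)[OF u(2)]
  have "a i \<otimes> b j \<ominus> a j \<otimes> b i \<in> L" if ij: "i \<le> n" "j \<le> n" for i j
  proof (cases i j rule: linorder_cases)
    case less
    then show ?thesis using lt ij by blast
  next
    case equal
    then show ?thesis using ideal_cong_refl[OF L] c ij by simp
  next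
    case greater
    have "a i \<otimes> b j \<ominus> a j \<otimes> b i = \<ominus> (a j \<otimes> b i \<ominus> a i \<otimes> b j)"
      using c(1)[OF ij(1)] c(1)[OF ij(2)] c(2)[OF ij(1)] c(2)[OF ij(2)] by algebra
    then show ?thesis
      using lt[OF greater ij(1)] additive_subgroup.a_inv_closed[OF ideal.axioms(1)[OF L]] by simp
  qed
  with u show "a \<in> unital_tuples R n \<and> b \<in> unital_tuples R n \<and>
    (\<forall>i\<le>n. \<forall>j\<le>n. a i \<otimes> b j \<ominus> a j \<otimes> b i \<in> L)"
    by blast
qed (auto simp: proj_rel_def)

lemma equiv_proj_rel:
  assumes L: "ideal L R"
  shows "equiv (unital_tuples R n) (proj_rel R L n)"
proof (rule equivI)
  show "proj_rel R L n \<subseteq> unital_tuples R n \<times> unital_tuples R n"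
    by (auto simp: proj_rel_def)
  show "refl_on (unital_tuples R n) (proj_rel R L n)"
  proof (rule refl_onI)
    fix a assume a: "a \<in> unital_tuples R n"
    have "a i \<otimes> a j \<ominus> a j \<otimes> a i \<in> L" if "i \<le> n" "j \<le> n" for i j
      using ideal_cong_refl[OF L, of "a i \<otimes> a j"] unital_tuplesD(1)[OF a] that m_comm[of "a j" "a i"]
      by simp
    with a show "(a, a) \<in> proj_rel R L n"
      by (simp add: proj_rel_iff[OF L])
  qed
  show "sym (proj_rel R L n)"
  proof (rule symI)
    fix a b assume ab: "(a, b) \<in> proj_rel R L n"
    then have u: "a \<in> unital_tuples R n" "b \<in> unital_tuples R n"
      by (auto simp: proj_rel_def)
    note c = unital_tuplesD(1)[OF u(1)] unital_tuplesD(1)[OF u(2)]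
    have "b i \<otimes> a j \<ominus> b j \<otimes> a i \<in> L" if ij: "i \<le> n" "j \<le> n" for i j
    proof -
      have "a j \<otimes> b i \<ominus> a i \<otimes> b j \<in> L"
        using ab ij by (simp add: proj_rel_iff[OF L])
      then show ?thesis
        using c[OF ij(1)] c[OF ij(2)] by (simp add: m_comm)
    qed
    with u show "(b, a) \<in> proj_rel R L n"
      by (simp add: proj_rel_iff[OF L])
  qed
  show "trans (proj_rel R L n)"
  proof (rule transI)
    fix a b c assume ab: "(a, b) \<in> proj_rel R L n" and bc: "(b, c) \<in> proj_rel R L n"
    then have u: "a \<in> unital_tuples R n" "b \<in> unital_tuples R n" "c \<in> unital_tuples R n"
      by (auto simp: proj_rel_def)
    note cl = unital_tuplesD(1)[OF u(1)] unital_tuplesD(1)[OF u(2)] unital_tuplesD(1)[OF u(3)]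
    interpret L: ideal L R by fact
    have "a i \<otimes> c j \<ominus> a j \<otimes> c i \<in> L" if ij: "i \<le> n" "j \<le> n" for i j
    proof (rule unital_tuple_cancel[OF L u(2)])
      show "a i \<otimes> c j \<ominus> a j \<otimes> c i \<in> carrier R"
        using cl ij by simp
      fix l assume l: "l \<le> n"
      let ?X = "a i \<otimes> b l \<ominus> a l \<otimes> b i" and ?Y = "b i \<otimes> c j \<ominus> b j \<otimes> c i"
        and ?Z = "a l \<otimes> b j \<ominus> a j \<otimes> b l"
      \<comment> \<open>Each minor of \<open>a\<close> and \<open>c\<close>, scaled by
        \<open>b l\<close>, is a combination of minors of \<open>a\<close>, \<open>b\<close> and of
        \<open>b\<close>, \<open>c\<close>. The factor \<open>b l\<close> is then cancelled because
        \<open>b\<close> is unital.\<close>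
      have "b l \<otimes> (a i \<otimes> c j \<ominus> a j \<otimes> c i) = ?X \<otimes> c j \<oplus> a l \<otimes> ?Y \<oplus> ?Z \<otimes> c i"
        using cl[OF ij(1)] cl[OF ij(2)] cl[OF l] by algebra
      moreover have "?X \<in> L" "?Y \<in> L" "?Z \<in> L"
        using ab bc ij l by (simp_all add: proj_rel_iff[OF L])
      ultimately show "b l \<otimes> (a i \<otimes> c j \<ominus> a j \<otimes> c i) \<in> L"
        using cl ij l by (simp add: L.I_l_closed L.I_r_closed L.a_closed)
    qed
    with u show "(a, c) \<in> proj_rel R L n"
      by (simp add: proj_rel_iff[OF L])
  qed
qed

lemma cong_imp_proj_rel:
  assumes L: "ideal L R" and a: "a \<in> unital_tuples R n" and b: "b \<in> unital_tuples R n"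
    and ab: "\<And>j. j \<le> n \<Longrightarrow> a j \<ominus> b j \<in> L"
  shows "(a, b) \<in> proj_rel R L n"
  unfolding proj_rel_iff[OF L]
proof (intro conjI allI impI a b)
  interpret L: ideal L R by fact
  fix i j assume ij: "i \<le> n" "j \<le> n"
  note c = unital_tuplesD(1)[OF a] unital_tuplesD(1)[OF b]
  \<comment> \<open>The terms \<open>b i \<otimes> b j\<close> introduced on the right
    cancel.\<close>
  have "a i \<otimes> b j \<ominus> a j \<otimes> b i = (a i \<ominus> b i) \<otimes> b j \<ominus> (a j \<ominus> b j) \<otimes> b i"
    using c[OF ij(1)] c[OF ij(2)] by algebra
  then show "a i \<otimes> b j \<ominus> a j \<otimes> b i \<in> L"
    using ab ij c by (simp add: ideal_minus_closed[OF L] L.I_r_closed)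
qed

section \<open>The image of the row map\<close>

text \<open>In the defining sum, the product of the other entries of column \<open>j\<close> serves
  as the coefficient of \<open>A i j\<close>. Hence the row classes do lie in
  \<open>PF\<close>.\<close>

lemma mat_variety_row_unital:
  assumes A: "A \<in> mat_variety R r (Suc n)" and i: "i < r"
  shows "A i \<in> unital_tuples R n"
proof -
  have row: "A l \<in> {..n} \<rightarrow>\<^sub>E carrier R" if "l < r" for l
    using A that by (auto simp: mat_variety_def lessThan_Suc_atMost)
  then have c: "A l j \<in> carrier R" if "l < r" "j \<le> n" for l j
    using that by (auto simp: PiE_iff)
  have "(\<Oplus>j\<in>{..n}. A i j \<otimes> (\<Otimes>l\<in>{..<r} - {i}. A l j)) = (\<Oplus>j\<in>{..n}. \<Otimes>l\<in>{..<r}. A l j)"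
  proof (rule finsum_cong')
    fix j assume j: "j \<in> {..n}"
    have "(\<Otimes>l\<in>insert i ({..<r} - {i}). A l j) = A i j \<otimes> (\<Otimes>l\<in>{..<r} - {i}. A l j)"
      using c i j by (intro finprod_insert) auto
    then show "A i j \<otimes> (\<Otimes>l\<in>{..<r} - {i}. A l j) = (\<Otimes>l\<in>{..<r}. A l j)"
      using i by (simp add: insert_absorb)
  qed (use c in \<open>auto intro!: finprod_closed\<close>)
  also have "\<dots> = \<one>"
    using A by (simp add: mat_variety_def lessThan_Suc_atMost)
  finally have "Idl (A i ` {..n}) = carrier R"
    using c i
    by (subst genideal_image_eq_carrier_iff)
      (auto intro!: finprod_closed bexI[of _ "\<lambda>j. \<Otimes>l\<in>{..<r} - {i}. A l j"])
  then show ?thesis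
    using row[OF i] by (simp add: unital_tuples_def)
qed

lemma maximal_ideal_monoid_ideal:
  assumes "J \<in> maximal_ideal_monoid R"
  shows "ideal J R"
  using assms
  by induction (auto intro: oneideal ideal_prod_is_ideal maximalideal.axioms(1))

theorem row_class_map_surj:
  assumes fin: "\<And>x. x \<in> carrier R \<Longrightarrow> x \<noteq> \<zero> \<Longrightarrow> finite {M. maximalideal M R \<and> x \<in> M}"
    and r: "r \<ge> 2" and k: "k \<ge> 2"
    and I: "\<And>i. i < r \<Longrightarrow> ideal (I i) R"
    and comax: "\<And>i j. i < r \<Longrightarrow> j < r \<Longrightarrow> i \<noteq> j \<Longrightarrow> I i <+>\<^bsub>R\<^esub> I j = carrier R"
  shows "row_class_map R I r k ` mat_variety R r k = (\<Pi>\<^sub>E i\<in>{..<r}. PF R (I i) (k - 1))"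
proof -
  define n where "n = k - 1"
  have n: "k = Suc n" using k by (simp add: n_def)
  show ?thesis
  proof (intro equalityI subsetI)
    fix f assume "f \<in> row_class_map R I r k ` mat_variety R r k"
    then obtain A where A: "A \<in> mat_variety R r (Suc n)" "f = row_class_map R I r k A"
      using n by blast
    have "proj_class R (I i) n (A i) \<in> PF R (I i) n" if "i < r" for i
      unfolding PF_def proj_class_def by (rule quotientI[OF mat_variety_row_unital[OF A(1) that]])
    then show "f \<in> (\<Pi>\<^sub>E i\<in>{..<r}. PF R (I i) (k - 1))"
      using A(2) n by (auto simp: row_class_map_def)
  next
    fix f assume f: "f \<in> (\<Pi>\<^sub>E i\<in>{..<r}. PF R (I i) (k - 1))"
    have "\<exists>b. b \<in> unital_tuples R n \<and> f i = proj_class R (I i) n b" if i: "i < r" for i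
    proof -
      have "f i \<in> unital_tuples R n // proj_rel R (I i) n"
        using f i n by (auto simp: PF_def)
      then show ?thesis
        by (auto simp: proj_class_def elim: quotientE)
    qed
    then obtain b where b: "\<And>i. i < r \<Longrightarrow> b i \<in> unital_tuples R n"
      and fb: "\<And>i. i < r \<Longrightarrow> f i = proj_class R (I i) n (b i)"
      by metis
    have "\<exists>A. (\<forall>i<r. \<forall>j<k. A i j \<in> carrier R \<and> A i j \<ominus> b i j \<in> I i) \<and>
        (\<Oplus>j\<in>{..<k}. \<Otimes>i\<in>{..<r}. A i j) = \<one>"
    proof (rule exists_matrix_congruent_rows)
      show "b i j \<in> carrier R" if "i < r" "j < k" for i j
        using unital_tuplesD(1)[OF b[OF that(1)]] that(2) n by simp
      show "Idl (b i ` {..<k}) = carrier R" if "i < r" for i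
        using unital_tuplesD(2)[OF b[OF that]] n by (simp add: lessThan_Suc_atMost)
    qed (use assms in auto)
    then obtain A where A: "\<And>i j. i < r \<Longrightarrow> j < k \<Longrightarrow> A i j \<in> carrier R"
      and Ab: "\<And>i j. i < r \<Longrightarrow> j < k \<Longrightarrow> A i j \<ominus> b i j \<in> I i"
      and A1: "(\<Oplus>j\<in>{..<k}. \<Otimes>i\<in>{..<r}. A i j) = \<one>"
      by auto
    \<comment> \<open>The matrix \<open>A\<close> is arbitrary outside its index range, while
      \<open>mat_variety\<close> asks for extensional functions.\<close>
    define A' where "A' = (\<lambda>i\<in>{..<r}. \<lambda>j\<in>{..<k}. A i j)"
    have "(\<Oplus>j\<in>{..<k}. \<Otimes>i\<in>{..<r}. A' i j) = (\<Oplus>j\<in>{..<k}. \<Otimes>i\<in>{..<r}. A i j)"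
    proof (rule finsum_cong')
      fix j assume "j \<in> {..<k}"
      then show "(\<Otimes>i\<in>{..<r}. A' i j) = (\<Otimes>i\<in>{..<r}. A i j)"
        using A by (intro finprod_cong') (auto simp: A'_def)
    qed (use A in \<open>auto intro!: finprod_closed\<close>)
    then have A': "A' \<in> mat_variety R r k"
      using A A1 by (auto simp: mat_variety_def A'_def)
    have "proj_class R (I i) n (A' i) = f i" if i: "i < r" for i
    proof -
      have "(A' i, b i) \<in> proj_rel R (I i) n"
      proof (rule cong_imp_proj_rel[OF I[OF i] _ b[OF i]])
        show "A' i \<in> unital_tuples R n"
          using mat_variety_row_unital A' i n by blast
        show "A' i j \<ominus> b i j \<in> I i" if "j \<le> n" for j
          using Ab[OF i, of j] that i n by (simp add: A'_def)
      qed
      then show ?thesis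
        unfolding fb[OF i] proj_class_def by (rule equiv_class_eq[OF equiv_proj_rel[OF I[OF i]]])
    qed
    \<comment> \<open>Outside \<open>{..<r}\<close> both sides are \<open>undefined\<close>.\<close>
    then have "row_class_map R I r k A' = f"
      using f n by (auto simp: row_class_map_def fun_eq_iff PiE_iff extensional_def)
    then show "f \<in> row_class_map R I r k ` mat_variety R r k"
      using A' by blast
  qed
qed

end

text \<open>In the field case the only ideals are zero and the whole ring, so no maximal ideal
  contains a nonzero element; otherwise finiteness is part of the definition.\<close>

lemma (in dedekind_type_domain) finite_maximalideals_containing:
  assumes x: "x \<in> carrier R" "x \<noteq> \<zero>"
  shows "finite {M. maximalideal M R \<and> x \<in> M}"
proof (cases "field R")
  case True
  interpret field R by fact
  have "\<not> (maximalideal M R \<and> x \<in> M)" for M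
  proof
    assume M: "maximalideal M R \<and> x \<in> M"
    then have "ideal M R" by (simp add: maximalideal.axioms(1))
    then have "M = {\<zero>} \<or> M = carrier R" using all_ideals by blast
    then show False using M x maximalideal.I_notcarr by blast
  qed
  then have "{M. maximalideal M R \<and> x \<in> M} = {}"
    by blast
  then show ?thesis by (simp only: finite.emptyI)
next
  case False
  then show ?thesis using field_or_dedekind_type x by auto
qed

theorem mainTheorem14:
  fixes R :: "('a, 'b) ring_scheme" (structure)
    and r k :: nat
    and I :: "nat \<Rightarrow> 'a set"
  assumes "dedekind_type_domain R"
    and "r \<ge> 2" and "k \<ge> 2"
    and "\<And>i. i < r \<Longrightarrow> I i \<in> maximal_ideal_monoid R"
    and "\<And>i j. i < r \<Longrightarrow> j < r \<Longrightarrow> i \<noteq> j \<Longrightarrow> I i <+>\<^bsub>R\<^esub> I j = carrier R"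
  shows "row_class_map R I r k ` mat_variety R r k = (\<Pi>\<^sub>E i\<in>{..<r}. PF R (I i) (k - 1))"
proof -
  interpret dedekind_type_domain R by fact
  show ?thesis
    by (rule row_class_map_surj[OF finite_maximalideals_containing assms(2,3)
          maximal_ideal_monoid_ideal[OF assms(4)] assms(5)])
qed

end
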